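(* Let $n\ge 2$ and $\varphi\in\Phi_2$. The operation $+_\varphi:\left(\mathcal{K}^n_s\right)^2\to\mathcal{K}^n_s$ is associative (i.e. $K+_\varphi(L+_\varphi N)=(K+_\varphi L)+_\varphi N$ for all $K,L,N\in\mathcal{K}^n_s$) if and only if $+_\varphi=+_p$ on $\left(\mathcal{K}^n_s\right)^2$, that is, $+_\varphi$ is $L_p$ addition, for some $1\le p\le\infty$. The same equivalence holds with $\mathcal{K}^n_s$ replaced by $\mathcal{K}^n_o$ throughout.
   Context: $\mathcal{K}^n_o$ is the class of compact convex subsets of $\mathbb{R}^n$ containing the origin $o$; $\mathcal{K}^n_s$ is the class of nonempty compact convex sets $K$ in $\mathbb{R}^n$ with $K=-K$. The support function of $K$ is $h_K(x)=\sup\{x\cdot y:y\in K\}$. $\Phi_2$ is the set of convex functions $\varphi:[0,\infty)^2\to[0,\infty)$ that are increasing (i.e. nondecreasing) in each variable and satisfy $\varphi(0,0)=0$ and $\varphi(1,0)=\varphi(0,1)=1$. For $\varphi\in\Phi_2$ and $K,L\in\mathcal{K}^n_o$, the Orlicz sum $K+_\varphi L$ is the compact convex set with support function $$h_{K+_\varphi L}(x)=\inf\left\{\lambda>0:\varphi\left(\frac{h_{K}(x)}{\lambda},\frac{h_{L}(x)}{\lambda}\right)\le 1\right\},\quad x\in\mathbb{R}^n;$$ it belongs to $\mathcal{K}^n_o$, and to $\mathcal{K}^n_s$ if $K,L\in\mathcal{K}^n_s$. For $K,L\in\mathcal{K}^n_o$, the $L_p$ sum $K+_pL$ is the compact convex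 set with $h_{K+_pL}(x)^p=h_K(x)^p+h_L(x)^p$ for $1\le p<\infty$, and $h_{K+_\infty L}(x)=\max\{h_K(x),h_L(x)\}$. *)

theory Defs
  imports "HOL-Analysis.Analysis"
begin

definition support_fun :: "'a::euclidean_space set \<Rightarrow> 'a \<Rightarrow> real" where
  "support_fun K x = (SUP y\<in>K. x \<bullet> y)"

definition convex_origin :: "'a::euclidean_space set set" where
  "convex_origin = {K. compact K \<and> convex K \<and> 0 \<in> K}"

definition convex_symmetric :: "'a::euclidean_space set set" where
  "convex_symmetric = {K. compact K \<and> convex K \<and> K \<noteq> {} \<and> K = uminus ` K}"

text \<open>A function on the closed quadrant is represented by a total function whose values off
  the quadrant are irrelevant: every condition here, and the Orlicz sum of sets containing the
  origin, only uses arguments that are nonnegative.\<close>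

definition Phi2 :: "(real \<Rightarrow> real \<Rightarrow> real) set" where
  "Phi2 = {\<phi>.
     convex_on ({0..} \<times> {0..}) (\<lambda>(s, t). \<phi> s t) \<and>
     (\<forall>s\<ge>0. \<forall>t\<ge>0. 0 \<le> \<phi> s t) \<and>
     (\<forall>t\<ge>0. mono_on {0..} (\<lambda>s. \<phi> s t)) \<and>
     (\<forall>s\<ge>0. mono_on {0..} (\<lambda>t. \<phi> s t)) \<and>
     \<phi> 0 0 = 0 \<and> \<phi> 1 0 = 1 \<and> \<phi> 0 1 = 1}"

text \<open>A nonempty compact convex set is determined by its support function; the condition
  \<open>M \<noteq> {}\<close> is needed because the real-valued supremum over the empty set is a junk value.\<close>

definition orlicz_sum ::
  "(real \<Rightarrow> real \<Rightarrow> real) \<Rightarrow> 'a::euclidean_space set \<Rightarrow> 'a set \<Rightarrow> 'a set" where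
  "orlicz_sum \<phi> K L = (THE M. compact M \<and> convex M \<and> M \<noteq> {} \<and>
     (\<forall>x. support_fun M x =
        Inf {r. r > 0 \<and> \<phi> (support_fun K x / r) (support_fun L x / r) \<le> 1}))"

text \<open>The exponent ranges over the extended reals from 1 to \<open>\<infinity>\<close>. For finite exponent the \<open>p\<close>-th
  power of the support function of \<open>M\<close> presupposes that this function is nonnegative, i.e. that
  \<open>M\<close> contains the origin; this has to be required explicitly because \<open>powr\<close> is also defined on
  negative reals.\<close>

definition lp_sum ::
  "ereal \<Rightarrow> 'a::euclidean_space set \<Rightarrow> 'a set \<Rightarrow> 'a set" where
  "lp_sum p K L = (THE M. compact M \<and> convex M \<and> 0 \<in> M \<and>
     (\<forall>x. if p = \<infinity>
          then support_fun M x = max (support_fun K x) (support_fun L x)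
          else support_fun M x powr real_of_ereal p =
               support_fun K x powr real_of_ereal p + support_fun L x powr real_of_ereal p))"

definition associative_on :: "'b set \<Rightarrow> ('b \<Rightarrow> 'b \<Rightarrow> 'b) \<Rightarrow> bool" where
  "associative_on C f \<longleftrightarrow> (\<forall>K\<in>C. \<forall>L\<in>C. \<forall>N\<in>C. f K (f L N) = f (f K L) N)"

end

theory Submission
  imports Defs
begin

text \<open>The Orlicz sum acts pointwise on support functions through the gauge
  \<open>F a b = inf {r > 0. \<phi> (a / r) (b / r) \<le> 1}\<close>, a monotone sublinear function on the quadrant with
  \<open>F 1 0 = F 0 1 = 1\<close>. Applied to centred balls, associativity of the sum becomes associativity
  of \<open>F\<close>. Let \<open>a n\<close> be the value of the \<open>n\<close>-fold \<open>F\<close>-sum \<open>1 + ... + 1\<close>. Homogeneity and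
  associativity give \<open>a (m * n) = a m * a n\<close> and \<open>F (a m) (a n) = a (m + n)\<close>, and a monotone
  multiplicative sequence is a power \<open>a n = n powr s\<close>. If \<open>s > 0\<close>, the second identity extends
  by homogeneity to rational and by monotonicity to real arguments, so that \<open>F\<close> is the
  \<open>p\<close>-norm with \<open>p = 1 / s\<close>; if \<open>s = 0\<close>, then \<open>F 1 1 = 1\<close> and \<open>F\<close> is the maximum.\<close>

section \<open>Support functions\<close>

lemma bdd_above_inner:
  fixes K :: "'a::euclidean_space set"
  assumes "compact K"
  shows "bdd_above ((\<lambda>y. x \<bullet> y) ` K)"
  by (intro bounded_imp_bdd_above compact_imp_bounded compact_continuous_image
      continuous_intros assms)

lemma support_fun_upper:
  fixes K :: "'a::euclidean_space set"
  assumes "compact K" "y \<in> K"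
  shows "x \<bullet> y \<le> support_fun K x"
  unfolding support_fun_def by (rule cSUP_upper[OF assms(2) bdd_above_inner[OF assms(1)]])

lemma support_fun_least:
  fixes K :: "'a::euclidean_space set"
  assumes "K \<noteq> {}" "\<And>y. y \<in> K \<Longrightarrow> x \<bullet> y \<le> c"
  shows "support_fun K x \<le> c"
  unfolding support_fun_def using assms by (intro cSUP_least) auto

lemma support_fun_nonneg:
  fixes K :: "'a::euclidean_space set"
  assumes "compact K" "0 \<in> K"
  shows "0 \<le> support_fun K x"
  using support_fun_upper[OF assms, of x] by simp

lemma support_fun_add_le:
  fixes K :: "'a::euclidean_space set"
  assumes "compact K" "K \<noteq> {}"
  shows "support_fun K (x + y) \<le> support_fun K x + support_fun K y"
  using assms by (intro support_fun_least) (auto simp: inner_add_left intro!: add_mono support_fun_upper)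

lemma support_fun_scaleR:
  fixes K :: "'a::euclidean_space set"
  assumes "compact K" "K \<noteq> {}" "0 \<le> c"
  shows "support_fun K (c *\<^sub>R x) = c * support_fun K x"
proof (cases "c = 0")
  case True
  then show ?thesis
    using assms by (simp add: support_fun_def)
next
  case False
  with assms have c: "c > 0" by simp
  have le: "support_fun K (c *\<^sub>R x) \<le> c * support_fun K x" if "c > 0" for c x
    using assms that by (intro support_fun_least) (auto intro!: mult_left_mono support_fun_upper)
  \<comment> \<open>The inequality for the factor \<open>inverse c\<close>, read at
    \<open>c *\<^sub>R x\<close>, is the reverse inequality for \<open>c\<close>.\<close>
  have "support_fun K x \<le> inverse c * support_fun K (c *\<^sub>R x)"
    using le[of "inverse c" "c *\<^sub>R x"] c by simp
  then show ?thesis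
    using le[OF c, of x] c by (simp add: field_simps)
qed

text \<open>Cauchy-Schwarz gives the upper bound, attained at the boundary point in the direction of
  \<open>x\<close>. Centred balls later serve as test bodies: they turn statements about bodies into
  statements about their radii.\<close>

lemma support_fun_cball:
  assumes "0 \<le> r"
  shows "support_fun (cball 0 r) x = r * norm (x :: 'a::euclidean_space)"
proof (rule antisym)
  show "support_fun (cball 0 r) x \<le> r * norm x"
  proof (rule support_fun_least)
    fix y :: 'a assume "y \<in> cball 0 r"
    then have "x \<bullet> y \<le> norm x * norm y" "norm x * norm y \<le> norm x * r"
      by (auto intro: norm_cauchy_schwarz mult_left_mono)
    then show "x \<bullet> y \<le> r * norm x"
      by (simp add: mult.commute)
  qed (use assms in auto)
  show "r * norm x \<le> support_fun (cball 0 r) x"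
  proof (cases "x = 0")
    case True
    then show ?thesis
      using support_fun_nonneg[of "cball 0 r" x] assms by simp
  next
    case False
    have "x \<bullet> ((r / norm x) *\<^sub>R x) = r * norm x"
      using False by (simp add: dot_square_norm power2_eq_square)
    moreover have "(r / norm x) *\<^sub>R x \<in> cball 0 r"
      using False assms by simp
    ultimately show ?thesis
      using support_fun_upper[of "cball 0 r" "(r / norm x) *\<^sub>R x" x] by simp
  qed
qed

lemma support_fun_uminus_image:
  "support_fun (uminus ` K) x = support_fun K (- x)"
  by (simp add: support_fun_def image_image)

text \<open>A point of \<open>K\<close> outside \<open>M\<close> would be strictly separated from
  \<open>M\<close> by a hyperplane, and in the normal direction \<open>- a\<close> the support
  function of \<open>K\<close> would exceed that of \<open>M\<close>.\<close>

lemma subset_if_support_fun_le: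
  fixes K M :: "'a::euclidean_space set"
  assumes "compact K" "compact M" "convex M" "M \<noteq> {}"
    and "\<And>x. support_fun K x \<le> support_fun M x"
  shows "K \<subseteq> M"
proof
  fix y assume y: "y \<in> K"
  show "y \<in> M"
  proof (rule ccontr)
    assume "y \<notin> M"
    then obtain a b where ab: "a \<bullet> y < b" "\<forall>w\<in>M. b < a \<bullet> w"
      using separating_hyperplane_closed_point[of M y] assms compact_imp_closed by blast
    have "support_fun M (- a) \<le> - b"
      using assms ab by (intro support_fun_least) (auto intro: less_imp_le)
    moreover have "- a \<bullet> y \<le> support_fun K (- a)"
      using assms y by (intro support_fun_upper)
    ultimately show False
      using assms(5)[of "- a"] ab by simp
  qed
qed

lemma support_fun_eqD:
  fixes K M :: "'a::euclidean_space set"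
  assumes "compact K" "convex K" "K \<noteq> {}" "compact M" "convex M" "M \<noteq> {}"
    and "\<And>x. support_fun K x = support_fun M x"
  shows "K = M"
  using assms by (intro antisym subset_if_support_fun_le) auto

text \<open>The linear functionals below a sublinear function are found by separating points just
  below its graph from its epigraph, which is a closed convex cone.\<close>

lemma sublinear_approx_from_below:
  fixes h :: "'a::euclidean_space \<Rightarrow> real"
  assumes add: "\<And>x y. h (x + y) \<le> h x + h y"
    and scale: "\<And>c x. 0 \<le> c \<Longrightarrow> h (c *\<^sub>R x) = c * h x"
    and "e > 0"
  shows "\<exists>y. (\<forall>x. x \<bullet> y \<le> h x) \<and> h x0 - e < x0 \<bullet> y"
proof -
  define E where "E = epigraph UNIV h"
  have conv: "convex_on UNIV h"
    unfolding convex_on_def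
  proof (intro conjI ballI allI impI convex_UNIV)
    fix x y :: 'a and u v :: real
    assume "0 \<le> u" "0 \<le> v"
    then show "h (u *\<^sub>R x + v *\<^sub>R y) \<le> u * h x + v * h y"
      using add[of "u *\<^sub>R x" "v *\<^sub>R y"] by (simp add: scale)
  qed
  have cont: "continuous_on UNIV h"
    using convex_on_continuous[OF open_UNIV conv] .
  have "convex E"
    unfolding E_def using conv by (rule convex_epigraphI)
  moreover have "closed E"
  proof -
    have "E = {z. h (fst z) \<le> snd z}"
      by (auto simp: E_def epigraph_def)
    then show ?thesis
      by (auto intro!: closed_Collect_le continuous_intros continuous_on_compose2[OF cont])
  qed
  moreover have "(x0, h x0 - e) \<notin> E"
    using \<open>e > 0\<close> by (simp add: E_def epigraph_def)
  ultimately obtain a b where ab: "a \<bullet> (x0, h x0 - e) < b" "\<And>w. w \<in> E \<Longrightarrow> b < a \<bullet> w"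
    using separating_hyperplane_closed_point[of E "(x0, h x0 - e)"] by blast
  obtain u s where a: "a = (u, s)" by (cases a)
  have h0: "h 0 = 0"
    using scale[of 0 0] by simp
  have inE: "(x, t) \<in> E \<longleftrightarrow> h x \<le> t" for x t
    by (simp add: E_def epigraph_def)
  \<comment> \<open>The apex of the cone \<open>E\<close> lies on the far side of the
    hyperplane.\<close>
  have b: "b < 0"
    using ab(2)[of "(0, 0)"] by (simp add: inE h0 a)
  \<comment> \<open>A functional bounded below on a cone is non-negative there: a point with
    negative value \<open>q\<close>, scaled by \<open>b / q\<close>, would have value exactly
    \<open>b\<close>.\<close>
  have cone: "0 \<le> u \<bullet> x + s * t" if "h x \<le> t" for x t
  proof (rule ccontr)
    define q where "q = u \<bullet> x + s * t"
    assume "\<not> 0 \<le> u \<bullet> x + s * t"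
    then have q: "q < 0" by (simp add: q_def)
    have c: "0 \<le> b / q" using b q by (simp add: divide_nonpos_neg)
    have "((b / q) *\<^sub>R x, (b / q) * t) \<in> E"
      using that c scale[OF c, of x] mult_left_mono[OF that c] by (simp only: inE)
    then have "b < (b / q) * q"
      using ab(2)[of "((b / q) *\<^sub>R x, (b / q) * t)"]
      by (simp add: a q_def distrib_left mult.left_commute)
    with q show False by simp
  qed
  have "u \<bullet> x0 + s * h x0 - s * e < 0"
    using ab(1) b by (simp add: a right_diff_distrib)
  moreover have "0 \<le> u \<bullet> x0 + s * h x0"
    by (rule cone) simp
  ultimately have "0 < s * e"
    by simp
  with \<open>e > 0\<close> have s: "s > 0"
    by (simp add: zero_less_mult_iff)
  \<comment> \<open>Since \<open>s > 0\<close>, the parallel hyperplane through the origin is not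
    vertical; it is the graph of the linear functional given by \<open>y\<close>.\<close>
  define y where "y = (- (1 / s)) *\<^sub>R u"
  have y: "x \<bullet> y = - (u \<bullet> x) / s" for x
    by (simp add: y_def inner_commute)
  have "x \<bullet> y \<le> h x" for x
    using cone[of x "h x"] s by (simp add: y field_simps)
  moreover have "h x0 - e < x0 \<bullet> y"
    using \<open>u \<bullet> x0 + s * h x0 - s * e < 0\<close> s by (simp add: y field_simps)
  ultimately show ?thesis by blast
qed

text \<open>The body is the set of all vectors whose linear functional is dominated by
  \<open>h\<close>. Functionals coming within any \<open>e > 0\<close> of \<open>h\<close> at a
  given point show that its support function is not smaller than \<open>h\<close>.\<close>

lemma sublinear_is_support_fun:
  fixes h :: "'a::euclidean_space \<Rightarrow> real"
  assumes add: "\<And>x y. h (x + y) \<le> h x + h y"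
    and scale: "\<And>c x. 0 \<le> c \<Longrightarrow> h (c *\<^sub>R x) = c * h x"
    and bound: "\<And>x. h x \<le> B * norm x"
  obtains M where "compact M" "convex M" "M \<noteq> {}" "\<And>x. support_fun M x = h x"
proof
  define M where "M = {y. \<forall>x. x \<bullet> y \<le> h x}"
  have M: "M = (\<Inter>x. {y. x \<bullet> y \<le> h x})"
    by (auto simp: M_def)
  show "convex M"
    unfolding M by (intro convex_INT convex_halfspace_le)
  have "closed M"
    unfolding M by (intro closed_INT ballI closed_halfspace_le)
  \<comment> \<open>Testing the constraint at \<open>x = y\<close> yields
    \<open>y \<bullet> y \<le> h y \<le> B * norm y\<close>.\<close>
  moreover have "bounded M"
  proof (rule boundedI)
    fix y assume "y \<in> M"
    then have "y \<bullet> y \<le> B * norm y"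
      using bound[of y] order_trans[of "y \<bullet> y" "h y"] by (simp add: M_def)
    then show "norm y \<le> max B 0"
      by (cases "y = 0") (auto simp: dot_square_norm power2_eq_square)
  qed
  ultimately show comp: "compact M"
    by (simp add: compact_eq_bounded_closed)
  show ne: "M \<noteq> {}"
    using sublinear_approx_from_below[of h 1 0] add scale by (auto simp: M_def)
  show "support_fun M x = h x" for x
  proof (rule antisym)
    show "support_fun M x \<le> h x"
      using ne by (intro support_fun_least) (auto simp: M_def)
    show "h x \<le> support_fun M x"
    proof (rule field_le_epsilon)
      fix e :: real assume "e > 0"
      then obtain y where "\<forall>x. x \<bullet> y \<le> h x" "h x - e < x \<bullet> y"
        using sublinear_approx_from_below[of h e x] add scale by blast
      then show "h x \<le> support_fun M x + e"
        using support_fun_upper[OF comp, of y x] by (simp add: M_def)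
    qed
  qed
qed

section \<open>Norms on the quadrant\<close>

text \<open>These are the properties shared by Orlicz gauges and \<open>p\<close>-norms that make
  the pointwise combination of two support functions a support function again. The quadrant suffices
  as domain, since bodies containing the origin have non-negative support functions.\<close>

locale quadrant_norm =
  fixes F :: "real \<Rightarrow> real \<Rightarrow> real"
  assumes subadd: "\<lbrakk>0 \<le> a; 0 \<le> b; 0 \<le> c; 0 \<le> d\<rbrakk> \<Longrightarrow> F (a + c) (b + d) \<le> F a b + F c d"
    and homogeneous: "\<lbrakk>0 \<le> k; 0 \<le> a; 0 \<le> b\<rbrakk> \<Longrightarrow> F (k * a) (k * b) = k * F a b"
    and mono: "\<lbrakk>0 \<le> a; a \<le> a'; 0 \<le> b; b \<le> b'\<rbrakk> \<Longrightarrow> F a b \<le> F a' b'"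
    and one_zero: "F 1 0 = 1"
    and zero_one: "F 0 1 = 1"
begin

lemma right_zero: "0 \<le> a \<Longrightarrow> F a 0 = a"
  using homogeneous[of a 1 0] by (simp add: one_zero)

lemma left_zero: "0 \<le> b \<Longrightarrow> F 0 b = b"
  using homogeneous[of b 0 1] by (simp add: zero_one)

lemma ge_left: "0 \<le> a \<Longrightarrow> 0 \<le> b \<Longrightarrow> a \<le> F a b"
  using mono[of a a 0 b] by (simp add: right_zero)

lemma ge_right: "0 \<le> a \<Longrightarrow> 0 \<le> b \<Longrightarrow> b \<le> F a b"
  using mono[of 0 a b b] by (simp add: left_zero)

lemma le_add: "0 \<le> a \<Longrightarrow> 0 \<le> b \<Longrightarrow> F a b \<le> a + b"
  using subadd[of a 0 0 b] by (simp add: right_zero left_zero)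

lemma nonneg: "0 \<le> a \<Longrightarrow> 0 \<le> b \<Longrightarrow> 0 \<le> F a b"
  using ge_left[of a b] by linarith

text \<open>Monotonicity lets the subadditivity of the two support functions pass through
  \<open>F\<close>, so the combination is sublinear. Being at most the sum of two functions of
  linear growth, it is the support function of a compact convex set.\<close>

lemma ex_combination:
  fixes K L :: "'a::euclidean_space set"
  assumes K: "K \<in> convex_origin" and L: "L \<in> convex_origin"
  obtains M where "M \<in> convex_origin"
    "\<And>x. support_fun M x = F (support_fun K x) (support_fun L x)"
proof -
  define h where "h x = F (support_fun K x) (support_fun L x)" for x
  have *: "compact K" "0 \<in> K" "K \<noteq> {}" "compact L" "0 \<in> L" "L \<noteq> {}"
    using K L by (auto simp: convex_origin_def)
  note nn = support_fun_nonneg[OF *(1,2)] support_fun_nonneg[OF *(4,5)]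
  have add: "h (x + y) \<le> h x + h y" for x y
  proof -
    have "h (x + y) \<le> F (support_fun K x + support_fun K y) (support_fun L x + support_fun L y)"
      unfolding h_def using * by (intro mono support_fun_add_le nn)
    also have "\<dots> \<le> h x + h y"
      unfolding h_def by (intro subadd nn)
    finally show ?thesis .
  qed
  have scale: "h (c *\<^sub>R x) = c * h x" if "0 \<le> c" for c x
    unfolding h_def using that * by (simp add: support_fun_scaleR homogeneous nn)
  have "\<exists>r. \<forall>x. support_fun A x \<le> r * norm x" if A: "compact A" "A \<noteq> {}" for A :: "'a set"
  proof -
    obtain r where r: "\<And>y. y \<in> A \<Longrightarrow> norm y \<le> r"
      using compact_imp_bounded[OF A(1)] by (auto simp: bounded_iff)
    have "x \<bullet> y \<le> r * norm x" if "y \<in> A" for x y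
      using norm_cauchy_schwarz[of x y] mult_right_mono[OF r[OF that], of "norm x"]
      by (simp add: mult.commute)
    then show ?thesis
      using A by (auto intro!: exI[of _ r] support_fun_least)
  qed
  then obtain r s where "\<And>x. support_fun K x \<le> r * norm x" "\<And>x. support_fun L x \<le> s * norm x"
    using * by metis
  then have bound: "h x \<le> (r + s) * norm x" for x
    using le_add[OF nn(1)[of x] nn(2)[of x]] by (smt (verit) h_def distrib_right)
  obtain M where M: "compact M" "convex M" "M \<noteq> {}" "\<And>x. support_fun M x = h x"
    using sublinear_is_support_fun[of h "r + s"] add scale bound by blast
  \<comment> \<open>The support function of \<open>{0}\<close> vanishes, and \<open>h\<close> is
    non-negative.\<close>
  have "{0} \<subseteq> M"
    using M nn by (intro subset_if_support_fun_le support_fun_least)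
      (auto simp: h_def support_fun_def intro!: nonneg)
  with M show thesis
    by (intro that) (auto simp: convex_origin_def h_def)
qed

end

text \<open>This is the Minkowski functional of the sublevel set \<open>\<phi> \<le> 1\<close> in
  the quadrant, isolated from the pointwise formula in \<open>orlicz_sum\<close>.\<close>

definition orlicz_gauge :: "(real \<Rightarrow> real \<Rightarrow> real) \<Rightarrow> real \<Rightarrow> real \<Rightarrow> real" where
  "orlicz_gauge \<phi> a b = Inf {r. r > 0 \<and> \<phi> (a / r) (b / r) \<le> 1}"

definition lp_norm :: "ereal \<Rightarrow> real \<Rightarrow> real \<Rightarrow> real" where
  "lp_norm p a b = (if p = \<infinity> then max a b
     else (a powr real_of_ereal p + b powr real_of_ereal p) powr (1 / real_of_ereal p))"

section \<open>Orlicz gauges as norms on the quadrant\<close>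

lemma Phi2_convex:
  assumes "\<phi> \<in> Phi2" "0 \<le> u" "0 \<le> v" "u + v = 1" "0 \<le> a" "0 \<le> b" "0 \<le> c" "0 \<le> d"
  shows "\<phi> (u * a + v * c) (u * b + v * d) \<le> u * \<phi> a b + v * \<phi> c d"
proof -
  have "convex_on ({0..} \<times> {0..}) (\<lambda>(s, t). \<phi> s t)"
    using assms by (simp add: Phi2_def)
  then show ?thesis
    unfolding convex_on_def using assms
    by (auto dest!: bspec[of _ _ "(a, b)"] bspec[of _ _ "(c, d)"] spec[of _ u] spec[of _ v])
qed

lemma Phi2_mono:
  assumes "\<phi> \<in> Phi2" "0 \<le> a" "a \<le> a'" "0 \<le> b" "b \<le> b'"
  shows "\<phi> a b \<le> \<phi> a' b'"
proof -
  have "\<phi> a b \<le> \<phi> a' b"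
    using assms by (auto simp: Phi2_def mono_on_def)
  also have "\<dots> \<le> \<phi> a' b'"
    using assms by (auto simp: Phi2_def mono_on_def)
  finally show ?thesis .
qed

text \<open>Convexity along an axis, with value 0 at the origin and 1 at the unit point, forces
  \<open>\<phi> a 0 \<ge> a\<close> for \<open>a > 1\<close>; monotonicity carries this to
  \<open>\<phi> a b\<close>. The second axis is symmetric.\<close>

lemma Phi2_sublevel_le_one:
  assumes "\<phi> \<in> Phi2" "0 \<le> a" "0 \<le> b" "\<phi> a b \<le> 1"
  shows "a \<le> 1" "b \<le> 1"
proof -
  have *: "\<phi> 0 0 = 0" "\<phi> 1 0 = 1" "\<phi> 0 1 = 1"
    using assms by (auto simp: Phi2_def)
  show "a \<le> 1"
  proof (rule ccontr)
    assume "\<not> a \<le> 1"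
    then have "1 \<le> 1 / a * \<phi> a 0"
      using Phi2_convex[of \<phi> "1 / a" "1 - 1 / a" a 0 0 0] assms * by (simp add: field_simps)
    with \<open>\<not> a \<le> 1\<close> show False
      using Phi2_mono[of \<phi> a a 0 b] assms by (simp add: field_simps)
  qed
  show "b \<le> 1"
  proof (rule ccontr)
    assume "\<not> b \<le> 1"
    then have "1 \<le> 1 / b * \<phi> 0 b"
      using Phi2_convex[of \<phi> "1 / b" "1 - 1 / b" 0 b 0 0] assms * by (simp add: field_simps)
    with \<open>\<not> b \<le> 1\<close> show False
      using Phi2_mono[of \<phi> 0 a b b] assms by (simp add: field_simps)
  qed
qed

text \<open>A lower bound of a set bounds its infimum only if the set is nonempty, so an admissible
  \<open>r\<close> has to be exhibited.\<close>

lemma orlicz_gauge_greatest: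
  assumes "\<phi> \<in> Phi2" "0 \<le> a" "0 \<le> b" "\<And>r. r > 0 \<Longrightarrow> \<phi> (a / r) (b / r) \<le> 1 \<Longrightarrow> c \<le> r"
  shows "c \<le> orlicz_gauge \<phi> a b"
proof -
  \<comment> \<open>With this \<open>r\<close> the point \<open>(a / r, b / r)\<close> lies below
    the segment from \<open>(1, 0)\<close> to \<open>(0, 1)\<close>, on which convexity gives
    \<open>\<phi> \<le> 1\<close>. The summand 1 keeps \<open>r\<close> positive when
    \<open>a = b = 0\<close>.\<close>
  define r where "r = a + b + 1"
  have *: "\<phi> 0 0 = 0" "\<phi> 1 0 = 1" "\<phi> 0 1 = 1"
    using assms by (auto simp: Phi2_def)
  have r: "r > 0" using assms by (simp add: r_def)
  have "\<phi> (a / r) (b / r) \<le> a / r * 1 + (1 - a / r) * 1"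
  proof -
    have "\<phi> (a / r * 1 + (1 - a / r) * 0) (a / r * 0 + (1 - a / r) * 1)
        \<le> a / r * \<phi> 1 0 + (1 - a / r) * \<phi> 0 1"
      using assms r by (intro Phi2_convex) (auto simp: r_def)
    moreover have "\<phi> (a / r) (b / r) \<le> \<phi> (a / r) (1 - a / r)"
      by (rule Phi2_mono[OF assms(1)]) (use assms r in \<open>auto simp: r_def field_simps\<close>)
    ultimately show ?thesis by (simp add: *)
  qed
  then have "r \<in> {r. r > 0 \<and> \<phi> (a / r) (b / r) \<le> 1}"
    using r by simp
  then show ?thesis
    unfolding orlicz_gauge_def using assms(4) by (intro cInf_greatest) auto
qed

lemma orlicz_gauge_lower:
  assumes "r > 0" "\<phi> (a / r) (b / r) \<le> 1"
  shows "orlicz_gauge \<phi> a b \<le> r"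
  unfolding orlicz_gauge_def using assms
  by (intro cInf_lower) (auto intro!: bdd_belowI[of _ 0])

text \<open>One half of homogeneity; the other half is the same inequality for the factor
  \<open>inverse k\<close>.\<close>

lemma orlicz_gauge_scale_le:
  assumes "\<phi> \<in> Phi2" "0 < k" "0 \<le> a" "0 \<le> b"
  shows "orlicz_gauge \<phi> (k * a) (k * b) \<le> k * orlicz_gauge \<phi> a b"
proof -
  have "orlicz_gauge \<phi> (k * a) (k * b) / k \<le> orlicz_gauge \<phi> a b"
  proof (rule orlicz_gauge_greatest)
    fix r assume "r > 0" "\<phi> (a / r) (b / r) \<le> 1"
    then have "orlicz_gauge \<phi> (k * a) (k * b) \<le> k * r"
      using assms by (intro orlicz_gauge_lower) auto
    then show "orlicz_gauge \<phi> (k * a) (k * b) / k \<le> r"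
      using assms by (simp add: field_simps)
  qed (use assms in auto)
  then show ?thesis
    using assms by (simp add: field_simps)
qed

lemma quadrant_norm_orlicz_gauge:
  assumes \<phi>: "\<phi> \<in> Phi2"
  shows "quadrant_norm (orlicz_gauge \<phi>)"
proof
  have *: "\<phi> 0 0 = 0" "\<phi> 1 0 = 1" "\<phi> 0 1 = 1"
    using \<phi> by (auto simp: Phi2_def)
  fix a b :: real
  assume ab: "0 \<le> a" "0 \<le> b"
  show "orlicz_gauge \<phi> (a + c) (b + d) \<le> orlicz_gauge \<phi> a b + orlicz_gauge \<phi> c d"
    if cd: "0 \<le> c" "0 \<le> d" for c d
  proof -
    \<comment> \<open>If \<open>r\<close> and \<open>s\<close> are admissible for the two points,
      then \<open>r + s\<close> is admissible for their sum, by convexity with weights proportional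
      to \<open>r\<close> and \<open>s\<close>.\<close>
    have sum: "orlicz_gauge \<phi> (a + c) (b + d) \<le> r + s"
      if r: "r > 0" "\<phi> (a / r) (b / r) \<le> 1" and s: "s > 0" "\<phi> (c / s) (d / s) \<le> 1" for r s
    proof (rule orlicz_gauge_lower)
      define u where "u = r / (r + s)"
      define v where "v = s / (r + s)"
      have uv: "0 \<le> u" "0 \<le> v" "u + v = 1"
        using r s by (auto simp: u_def v_def add_divide_distrib[symmetric])
      have eq: "(x + y) / (r + s) = u * (x / r) + v * (y / s)" for x y
        using r s by (simp add: u_def v_def add_divide_distrib)
      have "\<phi> ((a + c) / (r + s)) ((b + d) / (r + s)) \<le> u * \<phi> (a / r) (b / r) + v * \<phi> (c / s) (d / s)"
        unfolding eq using ab cd r s uv \<phi> by (intro Phi2_convex) auto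
      also have "\<dots> \<le> u * 1 + v * 1"
        using uv r s by (intro add_mono mult_left_mono) auto
      finally show "\<phi> ((a + c) / (r + s)) ((b + d) / (r + s)) \<le> 1"
        using uv by simp
    qed (use r s in auto)
    \<comment> \<open>The infimum is taken first over \<open>s\<close> with \<open>r\<close> fixed,
      then over \<open>r\<close>.\<close>
    have "orlicz_gauge \<phi> (a + c) (b + d) - r \<le> orlicz_gauge \<phi> c d"
      if "r > 0" "\<phi> (a / r) (b / r) \<le> 1" for r
      by (rule orlicz_gauge_greatest) (use \<phi> cd sum[OF that] in force)+
    then have "orlicz_gauge \<phi> (a + c) (b + d) - orlicz_gauge \<phi> c d \<le> orlicz_gauge \<phi> a b"
      using \<phi> ab by (intro orlicz_gauge_greatest) force+
    then show ?thesis by simp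
  qed
  show "orlicz_gauge \<phi> a b \<le> orlicz_gauge \<phi> a' b'" if "a \<le> a'" "b \<le> b'" for a' b'
  proof (rule orlicz_gauge_greatest)
    fix r assume r: "r > 0" "\<phi> (a' / r) (b' / r) \<le> 1"
    then have "\<phi> (a / r) (b / r) \<le> \<phi> (a' / r) (b' / r)"
      using Phi2_mono[OF \<phi>] ab that by (simp add: divide_right_mono)
    with r show "orlicz_gauge \<phi> a b \<le> r"
      by (intro orlicz_gauge_lower) auto
  qed (use \<phi> ab that in auto)
  show "orlicz_gauge \<phi> (k * a) (k * b) = k * orlicz_gauge \<phi> a b" if "0 \<le> k" for k
  proof (cases "k = 0")
    case True
    \<comment> \<open>At the origin every positive \<open>r\<close> is admissible, because
      \<open>\<phi> 0 0 = 0\<close>.\<close>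
    have "orlicz_gauge \<phi> 0 0 \<le> 0"
      by (rule field_le_epsilon) (auto simp: * intro: orlicz_gauge_lower)
    moreover have "0 \<le> orlicz_gauge \<phi> 0 0"
      using \<phi> by (intro orlicz_gauge_greatest) auto
    ultimately show ?thesis using True by simp
  next
    case False
    then have "k > 0" using that by simp
    have "orlicz_gauge \<phi> a b \<le> inverse k * orlicz_gauge \<phi> (k * a) (k * b)"
      using orlicz_gauge_scale_le[OF \<phi>, of "inverse k" "k * a" "k * b"] ab \<open>k > 0\<close>
      by (simp add: mult.assoc[symmetric])
    then have "k * orlicz_gauge \<phi> a b \<le> orlicz_gauge \<phi> (k * a) (k * b)"
      using \<open>k > 0\<close> by (simp add: field_simps)
    then show ?thesis
      using orlicz_gauge_scale_le[OF \<phi> \<open>k > 0\<close> ab] by simp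
  qed
next
  have *: "\<phi> 0 0 = 0" "\<phi> 1 0 = 1" "\<phi> 0 1 = 1"
    using \<phi> by (auto simp: Phi2_def)
  show "orlicz_gauge \<phi> 1 0 = 1"
  proof (intro antisym orlicz_gauge_lower orlicz_gauge_greatest)
    fix r :: real assume "r > 0" "\<phi> (1 / r) (0 / r) \<le> 1"
    then show "1 \<le> r"
      using Phi2_sublevel_le_one(1)[OF \<phi>, of "1 / r" 0] by simp
  qed (use \<phi> * in auto)
  show "orlicz_gauge \<phi> 0 1 = 1"
  proof (intro antisym orlicz_gauge_lower orlicz_gauge_greatest)
    fix r :: real assume "r > 0" "\<phi> (0 / r) (1 / r) \<le> 1"
    then show "1 \<le> r"
      using Phi2_sublevel_le_one(2)[OF \<phi>, of 0 "1 / r"] by simp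
  qed (use \<phi> * in auto)
qed

section \<open>The \<open>p\<close>-norms as norms on the quadrant\<close>

lemma powr_convex_nonneg:
  fixes q :: real
  assumes "1 \<le> q" "0 \<le> u" "0 \<le> v" "u + v = 1" "0 \<le> x" "0 \<le> y"
  shows "(u * x + v * y) powr q \<le> u * x powr q + v * y powr q"
proof -
  \<comment> \<open>This settles the boundary cases in which \<open>x\<close> or \<open>y\<close> is
    0; it rests on \<open>t powr q \<le> t\<close> for \<open>t\<close> in the unit
    interval.\<close>
  have small: "(t * z) powr q \<le> t * z powr q" if "0 \<le> t" "t \<le> 1" "0 \<le> z" for t z
  proof -
    have "t powr q \<le> t"
      using powr_mono'[of 1 q t] that assms by simp
    then show ?thesis
      using that by (simp add: powr_mult mult_right_mono)
  qed
  consider "x = 0" | "y = 0" | "x > 0" "y > 0"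
    using assms by fastforce
  then show ?thesis
  proof cases
    case 1
    then show ?thesis using small[of v y] assms by simp
  next
    case 2
    then show ?thesis using small[of u x] assms by simp
  next
    case 3
    then show ?thesis
      using powr_convex[OF \<open>1 \<le> q\<close>] assms by (simp add: convex_on_def)
  qed
qed

text \<open>Minkowski's inequality for two coordinates: both pairs are normalised to norm 1, and
  convexity of the power is applied with weights proportional to the two norms.\<close>

lemma powr_norm_subadd:
  fixes q a b c d :: real
  assumes q: "1 \<le> q" and nn: "0 \<le> a" "0 \<le> b" "0 \<le> c" "0 \<le> d"
  defines "N \<equiv> (\<lambda>x y. (x powr q + y powr q) powr (1 / q))"
  shows "N (a + c) (b + d) \<le> N a b + N c d"
proof -
  have N_powr: "N x y powr q = x powr q + y powr q" for x y
    unfolding N_def using q by (simp add: powr_powr)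
  have N_nonneg: "0 \<le> N x y" for x y
    by (simp add: N_def)
  \<comment> \<open>This covers the case in which normalising would divide by zero.\<close>
  have N_zero: "x = 0 \<and> y = 0" if "N x y = 0" for x y
    using N_powr[of x y] that q by (simp add: add_nonneg_eq_0_iff)
  show ?thesis
  proof (cases "N a b = 0 \<or> N c d = 0")
    case True
    then show ?thesis
      using N_zero[of a b] N_zero[of c d] N_nonneg[of 0 0] by auto
  next
    case False
    define r where "r = N a b"
    define s where "s = N c d"
    have r: "r > 0" and s: "s > 0"
      using False N_nonneg[of a b] N_nonneg[of c d] by (auto simp: r_def s_def less_le)
    define u where "u = r / (r + s)"
    define v where "v = s / (r + s)"
    have uv: "0 \<le> u" "0 \<le> v" "u + v = 1"
      using r s by (auto simp: u_def v_def add_divide_distrib[symmetric])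
    have eq: "(x + y) / (r + s) = u * (x / r) + v * (y / s)" for x y
      using r s by (simp add: u_def v_def add_divide_distrib)
    have le: "((x + y) / (r + s)) powr q \<le> u * (x / r) powr q + v * (y / s) powr q"
      if "0 \<le> x" "0 \<le> y" for x y
      unfolding eq using that uv r s q by (intro powr_convex_nonneg) auto
    have one: "(a / r) powr q + (b / r) powr q = 1" "(c / s) powr q + (d / s) powr q = 1"
      using N_powr[of a b, symmetric] N_powr[of c d, symmetric] nn r s
      by (simp_all add: powr_divide r_def[symmetric] s_def[symmetric] add_divide_distrib[symmetric])
    have "((a + c) / (r + s)) powr q + ((b + d) / (r + s)) powr q
        \<le> (u * (a / r) powr q + v * (c / s) powr q) + (u * (b / r) powr q + v * (d / s) powr q)"
      using nn by (intro add_mono le)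
    also have "\<dots> = u * ((a / r) powr q + (b / r) powr q) + v * ((c / s) powr q + (d / s) powr q)"
      by (simp add: algebra_simps)
    also have "\<dots> = 1"
      using uv by (simp add: one)
    finally have "(a + c) powr q + (b + d) powr q \<le> (r + s) powr q"
      using r s nn by (simp add: powr_divide add_divide_distrib[symmetric] divide_le_eq)
    then have "N (a + c) (b + d) \<le> ((r + s) powr q) powr (1 / q)"
      unfolding N_def using q by (intro powr_mono2) auto
    also have "\<dots> = r + s"
      using r s q by (simp add: powr_powr)
    finally show ?thesis by (simp add: r_def s_def)
  qed
qed

lemma quadrant_norm_lp_norm:
  assumes "1 \<le> p"
  shows "quadrant_norm (lp_norm p)"
proof (cases "p = \<infinity>")
  case True
  then show ?thesis
    by unfold_locales (auto simp: lp_norm_def max_def mult_le_cancel_left)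
next
  case False
  define q where "q = real_of_ereal p"
  have q: "1 \<le> q"
    using assms False by (cases p) (auto simp: q_def)
  have eq: "lp_norm p = (\<lambda>a b. (a powr q + b powr q) powr (1 / q))"
    using False by (auto simp: lp_norm_def q_def fun_eq_iff)
  show ?thesis
    unfolding eq
  proof
    fix a b :: real
    assume ab: "0 \<le> a" "0 \<le> b"
    show "((a + c) powr q + (b + d) powr q) powr (1 / q)
        \<le> (a powr q + b powr q) powr (1 / q) + (c powr q + d powr q) powr (1 / q)"
      if "0 \<le> c" "0 \<le> d" for c d
      using powr_norm_subadd[OF q ab that] .
    show "((k * a) powr q + (k * b) powr q) powr (1 / q) = k * (a powr q + b powr q) powr (1 / q)"
      if "0 \<le> k" for k
      using that ab q by (simp add: powr_mult distrib_left[symmetric] powr_powr)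
    show "(a powr q + b powr q) powr (1 / q) \<le> (a' powr q + b' powr q) powr (1 / q)"
      if "a \<le> a'" "b \<le> b'" for a' b'
      using that ab q by (intro powr_mono2 add_mono) auto
  qed (use q in auto)
qed

lemma lp_norm_assoc:
  assumes "1 \<le> p" "0 \<le> a" "0 \<le> b" "0 \<le> c"
  shows "lp_norm p a (lp_norm p b c) = lp_norm p (lp_norm p a b) c"
  using assms by (cases p) (auto simp: lp_norm_def powr_powr add.assoc max.assoc)

section \<open>Associative norms on the quadrant\<close>

text \<open>Enclosing \<open>n ^ k\<close> between consecutive powers of 2 and applying
  \<open>a\<close> puts \<open>k * log 2 (a n)\<close> and \<open>k * s * log 2 n\<close> in a
  common interval of length \<open>s\<close>; letting \<open>k\<close> grow makes the logarithms
  equal. The value at 0 is excluded because the constant sequence 1 is allowed, whereas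
  \<open>0 powr 0 = 0\<close>.\<close>

lemma monotone_multiplicative_powr:
  fixes a :: "nat \<Rightarrow> real"
  assumes mult: "\<And>m n. a (m * n) = a m * a n"
    and mono: "mono a" and one: "a 1 = 1"
  obtains s where "0 \<le> s" "\<And>n. n \<ge> 1 \<Longrightarrow> a n = real n powr s"
proof
  \<comment> \<open>The exponent is forced by the case \<open>n = 2\<close>.\<close>
  define s where "s = log 2 (a 2)"
  have ge1: "1 \<le> a n" if "n \<ge> 1" for n
    using monoD[OF mono that] one by simp
  show s0: "0 \<le> s"
    using ge1[of 2] by (simp add: s_def)
  have pow: "a (m ^ k) = a m ^ k" for m k
    using one by (induction k) (simp_all add: mult)
  show "a n = real n powr s" if n: "n \<ge> 1" for n
  proof -
    have bound: "real k * \<bar>log 2 (a n) - s * log 2 n\<bar> \<le> s" for k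
    proof -
      \<comment> \<open>The exponent of a power of 2 with
        \<open>2 ^ j \<le> n ^ k \<le> 2 ^ (j + 1)\<close>; \<open>nat\<close> loses nothing, as the
        logarithm is non-negative.\<close>
      define j where "j = nat \<lfloor>log 2 (real (n ^ k))\<rfloor>"
      have nk: "n ^ k \<ge> 1" using n by simp
      have l0: "0 \<le> log 2 (real (n ^ k))"
        using n by (simp add: log_nat_power)
      have j: "real j \<le> log 2 (real (n ^ k))" "log 2 (real (n ^ k)) \<le> real j + 1"
        using l0 unfolding j_def by linarith+
      have lognk: "log 2 (real (n ^ k)) = real k * log 2 n"
        using n by (simp add: log_nat_power)
      have "2 powr real j \<le> real (n ^ k)" "real (n ^ k) \<le> 2 powr (real j + 1)"
        using j nk by (simp_all only: le_log_iff log_le_iff)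
      then have "real (2 ^ j) \<le> real (n ^ k)" "real (n ^ k) \<le> real (2 ^ (j + 1))"
        by (auto simp: powr_add powr_realpow)
      then have "2 ^ j \<le> n ^ k" "n ^ k \<le> 2 ^ (j + 1)"
        by (simp_all only: of_nat_le_iff)
      then have "a 2 ^ j \<le> a n ^ k" "a n ^ k \<le> a 2 ^ (j + 1)"
        using monoD[OF mono] pow by metis+
      moreover have "0 < a 2" "0 < a n" using ge1[of 2] ge1[OF n] by linarith+
      ultimately have "log 2 (a 2 ^ j) \<le> log 2 (a n ^ k)" "log 2 (a n ^ k) \<le> log 2 (a 2 ^ (j + 1))"
        by (intro log_mono; simp)+
      then have A: "real j * s \<le> real k * log 2 (a n)" "real k * log 2 (a n) \<le> (real j + 1) * s"
        using \<open>0 < a 2\<close> \<open>0 < a n\<close> by (simp_all add: log_nat_power log_mult distrib_right s_def)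
      have B: "real j * s \<le> real k * log 2 n * s" "real k * log 2 n * s \<le> (real j + 1) * s"
        using j s0 unfolding lognk by (auto intro!: mult_right_mono)
      have "\<bar>real k * log 2 (a n) - real k * log 2 n * s\<bar> \<le> s"
        using A B by (simp add: distrib_right abs_le_iff)
      moreover have "\<bar>real k * log 2 (a n) - real k * log 2 n * s\<bar>
          = real k * \<bar>log 2 (a n) - s * log 2 n\<bar>"
        by (subst abs_of_nat[of k, where 'a = real, symmetric], subst abs_mult[symmetric])
          (simp add: algebra_simps)
      ultimately show ?thesis by simp
    qed
    have "\<bar>log 2 (a n) - s * log 2 n\<bar> = 0"
    proof (rule ccontr)
      assume "\<bar>log 2 (a n) - s * log 2 n\<bar> \<noteq> 0"
      then have "0 < \<bar>log 2 (a n) - s * log 2 n\<bar>" by simp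
      then obtain k where "s < real k * \<bar>log 2 (a n) - s * log 2 n\<bar>"
        using ex_less_of_nat_mult by blast
      with bound[of k] show False by simp
    qed
    then have "log 2 (a n) = log 2 (real n powr s)"
      using n by (simp add: log_powr)
    then show ?thesis
      using ge1[OF n] n by (subst (asm) log_inj[OF _, THEN inj_on_eq_iff]) auto
  qed
qed

text \<open>In the rescaled function \<open>G\<close> the claim reads \<open>G a b = a + b\<close>.
  It passes from integers to fractions with a common denominator by homogeneity, and to real
  arguments by monotone squeezing.\<close>

lemma (in quadrant_norm) associative_powr_sum:
  assumes s: "0 < s" and ab: "0 \<le> a" "0 \<le> b"
    and nat: "\<And>m n. F (real m powr s) (real n powr s) = real (m + n) powr s"
  shows "F (a powr s) (b powr s) = (a + b) powr s"
proof -
  define G where "G x y = F (x powr s) (y powr s) powr (1 / s)" for x y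
  have G_mono: "G x y \<le> G x' y'" if "0 \<le> x" "x \<le> x'" "0 \<le> y" "y \<le> y'" for x y x' y'
    unfolding G_def using that s by (intro powr_mono2 mono nonneg) auto
  have G_rat: "G (real m / k) (real n / k) = (real m + real n) / k" if k: "k > 0" for m n and k :: real
  proof -
    have "F ((real m / k) powr s) ((real n / k) powr s)
        = F ((1 / k) powr s * real m powr s) ((1 / k) powr s * real n powr s)"
      using k by (simp add: powr_divide)
    also have "\<dots> = ((real m + real n) / k) powr s"
      using k by (subst homogeneous) (auto simp: nat powr_divide)
    finally show ?thesis
      unfolding G_def using s k by (simp add: powr_powr)
  qed
  \<comment> \<open>Rounding \<open>k * a\<close> and \<open>k * b\<close> down loses at most 1
    each, whence the constant 2.\<close>
  have bound: "real k * \<bar>G a b - (a + b)\<bar> \<le> 2" for k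
  proof (cases "k = 0")
    case False
    then have k: "real k > 0" by simp
    define m where "m = nat \<lfloor>real k * a\<rfloor>"
    define n where "n = nat \<lfloor>real k * b\<rfloor>"
    have "0 \<le> real k * a" "0 \<le> real k * b" using ab by auto
    then have m: "real m \<le> real k * a" "real k * a \<le> real m + 1"
      and n: "real n \<le> real k * b" "real k * b \<le> real n + 1"
      unfolding m_def n_def by linarith+
    have "G (real m / k) (real n / k) \<le> G a b"
      using m n k by (intro G_mono) (auto simp: field_simps)
    moreover have "G a b \<le> G (real (m + 1) / k) (real (n + 1) / k)"
      using m n k ab by (intro G_mono) (auto simp: field_simps)
    ultimately have "(real m + real n) / k \<le> G a b" "G a b \<le> (real (m + 1) + real (n + 1)) / k"
      using G_rat[OF k, of m n] G_rat[OF k, of "m + 1" "n + 1"] by simp_all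
    then have "real m + real n \<le> real k * G a b" "real k * G a b \<le> real m + real n + 2"
      using k by (simp_all add: field_simps)
    then have "\<bar>real k * G a b - (real k * a + real k * b)\<bar> \<le> 2"
      using m n by linarith
    then have "\<bar>real k * (G a b - (a + b))\<bar> \<le> 2"
      by (simp add: algebra_simps)
    then show ?thesis by (simp add: abs_mult)
  qed simp
  have "\<bar>G a b - (a + b)\<bar> = 0"
  proof (rule ccontr)
    assume "\<bar>G a b - (a + b)\<bar> \<noteq> 0"
    then have "0 < \<bar>G a b - (a + b)\<bar>" by simp
    then obtain k where "2 < real k * \<bar>G a b - (a + b)\<bar>"
      using ex_less_of_nat_mult by blast
    with bound[of k] show False by simp
  qed
  then have "G a b powr s = (a + b) powr s" by simp
  then show ?thesis
    using s nonneg[of "a powr s" "b powr s"] by (simp add: G_def powr_powr)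
qed

text \<open>The exponent is read off from the growth \<open>n powr s\<close> of the iterated sums of
  1: \<open>p = 1 / s\<close> for \<open>s > 0\<close>, and \<open>p = \<infinity>\<close> for
  \<open>s = 0\<close>.\<close>

lemma (in quadrant_norm) associative_imp_lp_norm:
  assumes assoc: "\<And>a b c. \<lbrakk>0 \<le> a; 0 \<le> b; 0 \<le> c\<rbrakk> \<Longrightarrow> F a (F b c) = F (F a b) c"
  obtains p where "1 \<le> p" "\<And>a b. 0 \<le> a \<Longrightarrow> 0 \<le> b \<Longrightarrow> F a b = lp_norm p a b"
proof -
  \<comment> \<open>Starting from 0, which is neutral for \<open>F\<close>, makes the addition law
    hold for all indices, including 0.\<close>
  define A where "A = rec_nat 0 (\<lambda>_. F 1)"
  have A0: "A 0 = 0" and ASuc: "A (Suc n) = F 1 (A n)" for n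
    by (simp_all add: A_def)
  have A_nn: "0 \<le> A n" for n
    by (induction n) (auto simp: A0 ASuc nonneg)
  have A1: "A 1 = 1"
    by (simp add: A0 ASuc right_zero)
  have A_add: "F (A m) (A n) = A (m + n)" for m n
    by (induction m) (auto simp: A0 ASuc left_zero A_nn assoc[symmetric])
  have A_mult: "A (m * n) = A m * A n" for m n
  proof (induction m)
    case (Suc m)
    \<comment> \<open>Writing \<open>A n\<close> as \<open>A n * 1\<close> exposes a common factor
      that homogeneity pulls out.\<close>
    have "A (Suc m * n) = F (A n * 1) (A n * A m)"
      using Suc by (simp add: A_add[symmetric] mult.commute)
    also have "\<dots> = A (Suc m) * A n"
      using A_nn by (subst homogeneous) (auto simp: ASuc)
    finally show ?case .
  qed (simp add: A0)
  have "mono A"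
    by (rule incseq_SucI) (auto simp: ASuc A_nn intro: ge_right)
  then obtain s where s: "0 \<le> s" and As: "\<And>n. n \<ge> 1 \<Longrightarrow> A n = real n powr s"
    using monotone_multiplicative_powr[of A] A_mult A1 by blast
  show thesis
  proof (cases "s = 0")
    case True
    have F11: "F 1 1 = 1"
      using A_add[of 1 1] As[of 2] A1 True by (simp add: numeral_2_eq_2)
    have "F a b = max a b" if "0 \<le> a" "0 \<le> b" for a b
    proof (rule antisym)
      have "F a b \<le> F (max a b * 1) (max a b * 1)"
        using that by (intro mono) auto
      also have "\<dots> = max a b"
        using that by (subst homogeneous) (auto simp: F11)
      finally show "F a b \<le> max a b" .
    qed (use that ge_left ge_right in auto)
    then show thesis
      by (intro that[of \<infinity>]) (auto simp: lp_norm_def)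
  next
    case False
    then have s: "0 < s" using s by simp
    have As: "A n = real n powr s" for n
      using As[of n] A0 by (cases "n = 0") auto
    have F_powr: "F (a powr s) (b powr s) = (a + b) powr s" if "0 \<le> a" "0 \<le> b" for a b
      using s that by (rule associative_powr_sum) (use A_add in \<open>simp add: As\<close>)
    \<comment> \<open>The triangle inequality \<open>F 1 1 \<le> 2\<close> is what yields
      \<open>p = 1 / s \<ge> 1\<close>.\<close>
    have "2 powr s \<le> 2 powr 1"
      using le_add[of 1 1] F_powr[of 1 1] by simp
    then have "s \<le> 1"
      by (subst (asm) powr_le_cancel_iff) auto
    have "F a b = (a powr (1 / s) + b powr (1 / s)) powr s" if "0 \<le> a" "0 \<le> b" for a b
      using F_powr[of "a powr (1 / s)" "b powr (1 / s)"] that s by (simp add: powr_powr)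
    then show thesis
      using s \<open>s \<le> 1\<close> by (intro that[of "ereal (1 / s)"]) (auto simp: lp_norm_def)
  qed
qed

section \<open>The Orlicz sum and the Lp sum\<close>

text \<open>The definite description is meaningful: a witness comes from
  \<open>ex_combination\<close>, and support functions determine nonempty compact convex sets. The
  witness contains the origin, hence so does the sum.\<close>

lemma orlicz_sum_unfold:
  fixes K L :: "'a::euclidean_space set"
  assumes "\<phi> \<in> Phi2" "K \<in> convex_origin" "L \<in> convex_origin"
  shows orlicz_sum_in_convex_origin: "orlicz_sum \<phi> K L \<in> convex_origin"
    and support_fun_orlicz_sum: "support_fun (orlicz_sum \<phi> K L) x
      = orlicz_gauge \<phi> (support_fun K x) (support_fun L x)"
proof -
  interpret quadrant_norm "orlicz_gauge \<phi>"
    using assms(1) by (rule quadrant_norm_orlicz_gauge)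
  obtain M where M: "M \<in> convex_origin"
    "\<And>x. support_fun M x = orlicz_gauge \<phi> (support_fun K x) (support_fun L x)"
    using ex_combination[OF assms(2,3)] by blast
  have "orlicz_sum \<phi> K L = M"
    unfolding orlicz_sum_def orlicz_gauge_def[symmetric]
    using M by (intro the_equality support_fun_eqD) (auto simp: convex_origin_def)
  with M show "orlicz_sum \<phi> K L \<in> convex_origin"
    "support_fun (orlicz_sum \<phi> K L) x = orlicz_gauge \<phi> (support_fun K x) (support_fun L x)"
    by auto
qed

text \<open>It turns the implicit equation for powers in \<open>lp_sum\<close> into an explicit
  value, by taking roots of non-negative numbers.\<close>

lemma lp_norm_unique:
  assumes "1 \<le> p" "0 \<le> a" "0 \<le> b" "0 \<le> c"
  shows "(if p = \<infinity> then c = max a b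
    else c powr real_of_ereal p = a powr real_of_ereal p + b powr real_of_ereal p)
    \<longleftrightarrow> c = lp_norm p a b"
proof (cases "p = \<infinity>")
  case False
  define q where "q = real_of_ereal p"
  have q: "1 \<le> q"
    using assms False by (cases p) (auto simp: q_def)
  have "c = (c powr q) powr (1 / q)"
    using assms q by (simp add: powr_powr)
  moreover have "((a powr q + b powr q) powr (1 / q)) powr q = a powr q + b powr q"
    using q by (simp add: powr_powr)
  ultimately show ?thesis
    using False by (auto simp: lp_norm_def q_def[symmetric])
qed (simp add: lp_norm_def)

lemma lp_sum_unfold:
  fixes K L :: "'a::euclidean_space set"
  assumes p: "1 \<le> p" and K: "K \<in> convex_origin" and L: "L \<in> convex_origin"
  shows lp_sum_in_convex_origin: "lp_sum p K L \<in> convex_origin"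
    and support_fun_lp_sum: "support_fun (lp_sum p K L) x
      = lp_norm p (support_fun K x) (support_fun L x)"
proof -
  interpret quadrant_norm "lp_norm p"
    using p by (rule quadrant_norm_lp_norm)
  obtain M where M: "M \<in> convex_origin"
    "\<And>x. support_fun M x = lp_norm p (support_fun K x) (support_fun L x)"
    using ex_combination[OF K L] by blast
  \<comment> \<open>Here the condition that the body contains the origin enters: it makes its
    support function non-negative.\<close>
  have iff: "(if p = \<infinity> then support_fun N x = max (support_fun K x) (support_fun L x)
      else support_fun N x powr real_of_ereal p =
        support_fun K x powr real_of_ereal p + support_fun L x powr real_of_ereal p)
    \<longleftrightarrow> support_fun N x = lp_norm p (support_fun K x) (support_fun L x)"
    if "compact N" "0 \<in> N" for N :: "'a set" and x
    using p K L that by (intro lp_norm_unique support_fun_nonneg) (auto simp: convex_origin_def)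
  have "lp_sum p K L = M"
    unfolding lp_sum_def
  proof (rule the_equality)
    show "compact M \<and> convex M \<and> 0 \<in> M \<and>
      (\<forall>x. if p = \<infinity> then support_fun M x = max (support_fun K x) (support_fun L x)
        else support_fun M x powr real_of_ereal p =
          support_fun K x powr real_of_ereal p + support_fun L x powr real_of_ereal p)"
      using M iff[of M] by (auto simp: convex_origin_def)
  next
    fix N :: "'a set"
    assume N: "compact N \<and> convex N \<and> 0 \<in> N \<and>
      (\<forall>x. if p = \<infinity> then support_fun N x = max (support_fun K x) (support_fun L x)
        else support_fun N x powr real_of_ereal p =
          support_fun K x powr real_of_ereal p + support_fun L x powr real_of_ereal p)"
    then have "support_fun N x = support_fun M x" for x
      using iff[of N x] M(2)[of x] by metis
    with N M show "N = M"
      by (intro support_fun_eqD) (auto simp: convex_origin_def)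
  qed
  with M show "lp_sum p K L \<in> convex_origin"
    "support_fun (lp_sum p K L) x = lp_norm p (support_fun K x) (support_fun L x)"
    by auto
qed

section \<open>Associativity on classes of bodies\<close>

lemma convex_origin_eqI:
  fixes K M :: "'a::euclidean_space set"
  assumes "K \<in> convex_origin" "M \<in> convex_origin" "\<And>x. support_fun K x = support_fun M x"
  shows "K = M"
  using assms by (intro support_fun_eqD) (auto simp: convex_origin_def)

lemma convex_origin_support_nonneg:
  fixes K :: "'a::euclidean_space set"
  shows "K \<in> convex_origin \<Longrightarrow> 0 \<le> support_fun K x"
  by (auto simp: convex_origin_def support_fun_nonneg)

text \<open>One argument serves both classes: balls in \<open>C\<close> transfer associativity to
  the gauge, and closure under the sum keeps iterated sums in \<open>C\<close>.\<close>

lemma orlicz_sum_associative_iff: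
  fixes C :: "'a::euclidean_space set set"
  assumes \<phi>: "\<phi> \<in> Phi2"
    and sub: "C \<subseteq> convex_origin"
    and balls: "\<And>r. 0 \<le> r \<Longrightarrow> cball 0 r \<in> C"
    and closed: "\<And>K L. \<lbrakk>K \<in> C; L \<in> C\<rbrakk> \<Longrightarrow> orlicz_sum \<phi> K L \<in> C"
  shows "associative_on C (orlicz_sum \<phi>) \<longleftrightarrow>
    (\<exists>p::ereal. 1 \<le> p \<and> (\<forall>K\<in>C. \<forall>L\<in>C. orlicz_sum \<phi> K L = lp_sum p K L))"
proof
  interpret quadrant_norm "orlicz_gauge \<phi>"
    using \<phi> by (rule quadrant_norm_orlicz_gauge)
  assume assoc: "associative_on C (orlicz_sum \<phi>)"
  \<comment> \<open>In a unit direction the support function of a centred ball is its radius, so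
    evaluating there gives the scalar identity.\<close>
  obtain e :: 'a where e: "norm e = 1"
    using norm_Basis SOME_Basis by blast
  have ball: "support_fun (cball 0 r) e = r" if "0 \<le> r" for r
    using support_fun_cball[OF that, of e] e by simp
  have "orlicz_gauge \<phi> a (orlicz_gauge \<phi> b c) = orlicz_gauge \<phi> (orlicz_gauge \<phi> a b) c"
    if nn: "0 \<le> a" "0 \<le> b" "0 \<le> c" for a b c
  proof -
    let ?B = "\<lambda>r. cball (0::'a) r"
    have in_C: "?B a \<in> C" "?B b \<in> C" "?B c \<in> C"
      using balls nn by auto
    then have "orlicz_sum \<phi> (?B a) (orlicz_sum \<phi> (?B b) (?B c))
        = orlicz_sum \<phi> (orlicz_sum \<phi> (?B a) (?B b)) (?B c)"
      using assoc by (simp add: associative_on_def)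
    then have "support_fun (orlicz_sum \<phi> (?B a) (orlicz_sum \<phi> (?B b) (?B c))) e
        = support_fun (orlicz_sum \<phi> (orlicz_sum \<phi> (?B a) (?B b)) (?B c)) e"
      by simp
    moreover have "?B a \<in> convex_origin" "?B b \<in> convex_origin" "?B c \<in> convex_origin"
      using in_C sub by auto
    ultimately show ?thesis
      using \<phi> nn by (simp add: support_fun_orlicz_sum orlicz_sum_in_convex_origin ball)
  qed
  then obtain p where p: "1 \<le> p"
    "\<And>a b. 0 \<le> a \<Longrightarrow> 0 \<le> b \<Longrightarrow> orlicz_gauge \<phi> a b = lp_norm p a b"
    using associative_imp_lp_norm by metis
  have "orlicz_sum \<phi> K L = lp_sum p K L" if "K \<in> C" "L \<in> C" for K L
  proof -
    have KL: "K \<in> convex_origin" "L \<in> convex_origin" using that sub by auto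
    with \<phi> p show ?thesis
      by (intro convex_origin_eqI orlicz_sum_in_convex_origin lp_sum_in_convex_origin)
        (auto simp: support_fun_orlicz_sum support_fun_lp_sum convex_origin_support_nonneg)
  qed
  with p show "\<exists>p::ereal. 1 \<le> p \<and> (\<forall>K\<in>C. \<forall>L\<in>C. orlicz_sum \<phi> K L = lp_sum p K L)"
    by blast
next
  assume "\<exists>p::ereal. 1 \<le> p \<and> (\<forall>K\<in>C. \<forall>L\<in>C. orlicz_sum \<phi> K L = lp_sum p K L)"
  then obtain p :: ereal where p: "1 \<le> p"
    and eq: "\<And>K L. K \<in> C \<Longrightarrow> L \<in> C \<Longrightarrow> orlicz_sum \<phi> K L = lp_sum p K L"
    by blast
  show "associative_on C (orlicz_sum \<phi>)"
    unfolding associative_on_def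
  proof (intro ballI)
    fix K L N assume KLN: "K \<in> C" "L \<in> C" "N \<in> C"
    have "K \<in> convex_origin" "L \<in> convex_origin" "N \<in> convex_origin"
      using KLN sub by auto
    then have "lp_sum p K (lp_sum p L N) = lp_sum p (lp_sum p K L) N"
      using p by (intro convex_origin_eqI lp_sum_in_convex_origin)
        (auto simp: support_fun_lp_sum lp_sum_in_convex_origin lp_norm_assoc
          convex_origin_support_nonneg)
    \<comment> \<open>The inner sums must lie in \<open>C\<close> before \<open>eq\<close> can be
      applied to the outer ones; closure is known for Orlicz sums and transfers through
      \<open>eq\<close>.\<close>
    moreover have "lp_sum p L N \<in> C" "lp_sum p K L \<in> C"
      using KLN eq closed by metis+
    ultimately show "orlicz_sum \<phi> K (orlicz_sum \<phi> L N) = orlicz_sum \<phi> (orlicz_sum \<phi> K L) N"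
      using KLN by (simp add: eq)
  qed
qed

text \<open>The origin is the midpoint of \<open>x\<close> and \<open>- x\<close>, so symmetric
  bodies are bodies containing the origin.\<close>

lemma convex_symmetric_eq:
  "convex_symmetric = {K \<in> convex_origin. K = uminus ` K}"
proof -
  have "0 \<in> K" if "convex K" "K \<noteq> {}" "K = uminus ` K" for K :: "'a set"
  proof -
    obtain x where "x \<in> K"
      using \<open>K \<noteq> {}\<close> by blast
    moreover have "- x \<in> K"
      using imageI[OF \<open>x \<in> K\<close>, of uminus] that(3) by simp
    ultimately have "(1 / 2) *\<^sub>R x + (1 / 2) *\<^sub>R (- x) \<in> K"
      using \<open>convex K\<close> by (intro convexD) auto
    then show ?thesis by simp
  qed
  then show ?thesis
    by (auto simp: convex_symmetric_def convex_origin_def)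
qed

text \<open>Symmetric bodies have even support functions, so the support function of the sum is even
  too; the sum and its reflection therefore coincide.\<close>

lemma orlicz_sum_in_convex_symmetric:
  fixes K L :: "'a::euclidean_space set"
  assumes "\<phi> \<in> Phi2" "K \<in> convex_symmetric" "L \<in> convex_symmetric"
  shows "orlicz_sum \<phi> K L \<in> convex_symmetric"
proof -
  let ?M = "orlicz_sum \<phi> K L"
  have KL: "K \<in> convex_origin" "L \<in> convex_origin" "uminus ` K = K" "uminus ` L = L"
    using assms by (auto simp: convex_symmetric_eq)
  have M: "?M \<in> convex_origin"
    using assms KL by (intro orlicz_sum_in_convex_origin)
  have "support_fun K (- x) = support_fun K x" "support_fun L (- x) = support_fun L x" for x
    using KL by (metis support_fun_uminus_image)+
  then have "support_fun ?M x = support_fun (uminus ` ?M) x" for x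
    using assms KL by (simp add: support_fun_uminus_image support_fun_orlicz_sum)
  moreover have "uminus ` ?M \<in> convex_origin"
    using M by (auto simp: convex_origin_def compact_negations convex_negations)
  ultimately have "?M = uminus ` ?M"
    using M by (intro convex_origin_eqI)
  with M show ?thesis
    by (simp add: convex_symmetric_eq)
qed

theorem theorem5p10:
  fixes \<phi> :: "real \<Rightarrow> real \<Rightarrow> real"
  assumes "CARD('n::finite) \<ge> 2"
    and "\<phi> \<in> Phi2"
  shows "(associative_on (convex_symmetric :: (real ^ 'n) set set) (orlicz_sum \<phi>) \<longleftrightarrow>
          (\<exists>p::ereal. 1 \<le> p \<and>
             (\<forall>K\<in>(convex_symmetric :: (real ^ 'n) set set). \<forall>L\<in>convex_symmetric.
                orlicz_sum \<phi> K L = lp_sum p K L))) \<and>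
         (associative_on (convex_origin :: (real ^ 'n) set set) (orlicz_sum \<phi>) \<longleftrightarrow>
          (\<exists>p::ereal. 1 \<le> p \<and>
             (\<forall>K\<in>(convex_origin :: (real ^ 'n) set set). \<forall>L\<in>convex_origin.
                orlicz_sum \<phi> K L = lp_sum p K L)))"
proof (intro conjI orlicz_sum_associative_iff)
  show "cball (0 :: real ^ 'n) r \<in> convex_origin" if "0 \<le> r" for r
    using that by (simp add: convex_origin_def)
  show "cball (0 :: real ^ 'n) r \<in> convex_symmetric" if "0 \<le> r" for r
  proof -
    have "cball (0 :: real ^ 'n) r = uminus ` cball 0 r"
    proof (intro set_eqI iffI)
      fix x :: "real ^ 'n" assume "x \<in> cball 0 r"
      then show "x \<in> uminus ` cball 0 r"
        by (intro image_eqI[of _ _ "- x"]) auto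
    qed auto
    then show ?thesis
      using that by (simp add: convex_symmetric_eq convex_origin_def)
  qed
  show "convex_symmetric \<subseteq> (convex_origin :: (real ^ 'n) set set)"
    by (auto simp: convex_symmetric_eq)
qed (use assms in \<open>simp_all add: orlicz_sum_in_convex_origin orlicz_sum_in_convex_symmetric\<close>)

end
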